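(* (1) Let $V$ be a subgroup of $\mathcal{L}_n$. Then $V$ defines a triple $(s,V_0,v)$, where $s\in\mathbb{N}$ is such that $s\mathbb{Z}$ is the image of $V$ under the projection $\mathcal{L}_n\to\mathbb{Z}$, $V_0=V\cap\mathcal{A}_n$, which satisfies $x^sV_0=V_0$, and $v\in\mathcal{A}_n$ is such that $(v,s)\in V$. The element $v$ is uniquely defined up to addition of elements of $V_0$. For $s=0$ one can choose $v=0$. (2) Conversely, any triple $(s,V_0,v)$ with such properties (that is, $s\in\mathbb{N}$, $V_0$ a subgroup of $\mathcal{A}_n$ with $x^sV_0=V_0$, $v\in\mathcal{A}_n$, and $v\in V_0$ if $s=0$) is the triple of a subgroup of $\mathcal{L}_n$. Two such triples $(s,V_0,v)$ and $(s',V_0',v')$ define the same subgroup if and only if $s=s'$, $V_0=V_0'$ and $v+V_0=v'+V_0$. (3) If $V$ and $V'$ are subgroups of $\mathcal{L}_n$ with triples $(s,V_0,v)$ and $(s',V_0',v')$, then $V\subset V'$ if and only if $s'\mid s$, $V_0\subset V_0'$ and $v\equiv\varphi_{s/s'}(x^{s'})v' \pmod{V_0'}$.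
   Context: $p$ is a fixed prime, $n\ge 1$, $R=\mathbb{F}_p[x,x^{-1}]$, and $\mathbb{N}$ contains $0$. $\mathcal{A}_n=\bigoplus_{\mathbb{Z}}(\mathbb{Z}/p\mathbb{Z})^n$ is identified with the additive group of $R^n$, so that the shift by one on $\mathcal{A}_n$ is multiplication by $x$. $\mathcal{L}_n=(\mathbb{Z}/p\mathbb{Z})^n\wr\mathbb{Z}=\mathcal{A}_n\rtimes\mathbb{Z}$, with elements written $(v,s)$, $v\in\mathcal{A}_n$, $s\in\mathbb{Z}$, and multiplication $(v,s)(w,t)=(v+x^sw,s+t)$; $\mathcal{A}_n$ is identified with the subgroup $\{(v,0)\}$. For $t\ge 1$, $\varphi_t(x)=1+x+\dots+x^{t-1}$, and $\varphi_0=0$. If $s'=0$, then $s'\mid s$ means $s=0$, and the last condition in (3) is read as $v\in V_0'$ (which is then automatic once $V_0\subset V_0'$). *)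

theory Defs
  imports
    "HOL-Algebra.Group"
    "HOL-Analysis.Cartesian_Space"
    "HOL-Library.Poly_Mapping"
    "Berlekamp_Zassenhaus.Finite_Field"
begin

text \<open>
  The prime is $p$ = \<open>CARD('p)\<close> and the rank is $n$ = \<open>CARD('n)\<close>.  The ring
  $R = F_p[x,x^{-1}]$ is the type of finitely supported functions from the integers to $F_p$;
  the value at \<open>k\<close> is the coefficient of $x^k$, and \<open>*\<close> on this type is convolution.
\<close>

type_synonym 'p laurent = "int \<Rightarrow>\<^sub>0 'p mod_ring"

type_synonym ('p, 'n) base = "('p laurent, 'n) vec"

definition xpow :: "int \<Rightarrow> 'p::prime_card laurent" where
  "xpow s = Poly_Mapping.single s 1"

text \<open>
  \<open>phi t y\<close> is the value of the polynomial $1 + x + \dots + x^{t-1}$ at \<open>y\<close>; it is \<open>0\<close> for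
  \<open>t = 0\<close>.  Since \<open>s div 0 = 0\<close> on \<open>nat\<close>, for \<open>s' = 0\<close> the condition
  \<open>v - phi (s div s') (xpow (int s')) *s v' \<in> V0'\<close> means \<open>v \<in> V0'\<close>, as intended.
\<close>

definition phi :: "nat \<Rightarrow> 'a::comm_ring_1 \<Rightarrow> 'a" where
  "phi t y = (\<Sum>k<t. y ^ k)"

definition base_group :: "('p::prime_card, 'n::finite) base monoid" where
  "base_group = \<lparr>carrier = UNIV, monoid.mult = (+), one = 0\<rparr>"

definition lamplighter :: "(('p::prime_card, 'n::finite) base \<times> int) monoid" where
  "lamplighter =
    \<lparr>carrier = UNIV,
     monoid.mult = (\<lambda>(v, s) (w, t). (v + xpow s *s w, s + t)),
     one = (0, 0)\<rparr>"

text \<open>The intersection with the base group, where \<open>v\<close> is identified with \<open>(v, 0)\<close>.\<close>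

definition base_part :: "(('p::prime_card, 'n::finite) base \<times> int) set \<Rightarrow> ('p, 'n) base set" where
  "base_part V = {v. (v, 0) \<in> V}"

definition has_triple ::
  "(('p::prime_card, 'n::finite) base \<times> int) set \<Rightarrow>
    nat \<Rightarrow> ('p, 'n) base set \<Rightarrow> ('p, 'n) base \<Rightarrow> bool" where
  "has_triple V s V0 v \<longleftrightarrow>
    snd ` V = range (\<lambda>k. int s * k) \<and> V0 = base_part V \<and> (v, int s) \<in> V"

definition admissible ::
  "nat \<Rightarrow> ('p::prime_card, 'n::finite) base set \<Rightarrow> ('p, 'n) base \<Rightarrow> bool" where
  "admissible s V0 v \<longleftrightarrow>
    subgroup V0 base_group \<and> (\<lambda>w. xpow (int s) *s w) ` V0 = V0 \<and> (s = 0 \<longrightarrow> v \<in> V0)"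

lemma xpow_0: "xpow 0 = 1"
  by (simp add: xpow_def)

lemma xpow_add: "xpow (s + t) = xpow s * xpow t"
  by (simp add: xpow_def mult_single)

lemma xpow_of_nat: "xpow (int k) = xpow 1 ^ k"
proof (induction k)
  case (Suc k)
  have "int (Suc k) = 1 + int k" by simp
  then show ?case using Suc by (simp only: xpow_add power_Suc)
qed (simp add: xpow_0)

text \<open>Multiplication by \<open>xpow s\<close> is the shift by \<open>s\<close> on the direct sum over the integers.\<close>

lemma lookup_xpow_mult:
  "Poly_Mapping.lookup (xpow s * f) k = Poly_Mapping.lookup f (k - s)"
proof -
  have "Poly_Mapping.lookup (xpow s * f) k =
      (\<Sum>a. (1 when s = a) * (\<Sum>b. Poly_Mapping.lookup f b when k = a + b))"
    by (simp add: xpow_def lookup_mult lookup_single)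
  also have "\<dots> = (\<Sum>b. Poly_Mapping.lookup f b when k = s + b)"
    by (simp add: mult_when when_mult)
  also have "\<dots> = (\<Sum>b. Poly_Mapping.lookup f b when b = k - s)"
    by (intro Sum_any.cong) (auto simp: when_def)
  also have "\<dots> = Poly_Mapping.lookup f (k - s)"
    by simp
  finally show ?thesis .
qed

lemma group_base_group: "group base_group"
  by (rule groupI) (auto simp: base_group_def add.assoc intro: exI[of _ "- x" for x])

lemma group_lamplighter: "group (lamplighter :: (('p::prime_card, 'n::finite) base \<times> int) monoid)"
proof (rule groupI)
  fix a :: "('p, 'n) base \<times> int"
  obtain v s where "a = (v, s)" by force
  then show "\<exists>b\<in>carrier lamplighter. b \<otimes>\<^bsub>lamplighter\<^esub> a = \<one>\<^bsub>lamplighter\<^esub>"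
    by (intro bexI[of _ "(- (xpow (- s) *s v), - s)"]) (auto simp: lamplighter_def)
qed (auto simp: lamplighter_def xpow_0 xpow_add vector_add_ldistrib vector_smult_assoc add.assoc)

end

theory Submission
  imports
    Defs
    "HOL-Algebra.Generated_Groups"
    "HOL-Computational_Algebra.Group_Closure"
begin

text \<open>
  A subgroup \<open>V\<close> with triple \<open>(s, V0, v)\<close> is determined by the triple, because each of its
  elements differs from a power of \<open>g = (v, s)\<close> by an element of \<open>V0\<close>; that is,
  \<open>V\<close> is the product of \<open>V0\<close> and the cyclic group generated by \<open>g\<close>.  This product is a subgroup
  whenever conjugation by \<open>g\<close>, which acts on the base group as the shift by \<open>s\<close>, preserves
  \<open>V0\<close>.  The inclusion criterion follows by comparing \<open>g\<close> with the power of \<open>(v', s')\<close> that lies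
  over the same integer.
\<close>

section \<open>Subgroups of the integers\<close>

lemma int_subgroup_eq_range:
  fixes H :: "int set"
  assumes "0 \<in> H" and "\<And>a b. a \<in> H \<Longrightarrow> b \<in> H \<Longrightarrow> a - b \<in> H"
  obtains s :: nat where "H = range (\<lambda>k. int s * k)"
proof
  have "a \<in> H" if "a \<in> group_closure H" for a
    using that by induction (use assms in auto)
  then have "H = group_closure H"
    by (auto intro: group_closure.base)
  \<comment> \<open>The generator is \<open>Gcd H\<close>; it is nonnegative, so passing through
    \<open>nat\<close> does not change it.\<close>
  then show "H = range (\<lambda>k. int (nat (Gcd H)) * k)"
    using group_closure_eq[of H] by simp
qed

lemma range_int_mult_subset_iff:
  "range (\<lambda>k. int s * k) \<subseteq> range (\<lambda>k. int t * k) \<longleftrightarrow> t dvd s"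
proof
  assume "range (\<lambda>k. int s * k) \<subseteq> range (\<lambda>k. int t * k)"
  then have "int s * 1 \<in> range (\<lambda>k. int t * k)" by blast
  then obtain k where "int s = int t * k" by auto
  then have "int t dvd int s" by (rule dvdI)
  then show "t dvd s" by simp
qed (auto simp: mult.assoc elim!: dvdE)

lemma range_int_mult_eq_iff:
  "range (\<lambda>k. int s * k) = range (\<lambda>k. int t * k) \<longleftrightarrow> s = t"
  by (metis dvd_antisym order_refl range_int_mult_subset_iff)

section \<open>Subgroups of the base group and their cosets\<close>

lemma base_group_simps [simp]:
  "carrier base_group = UNIV" "a \<otimes>\<^bsub>base_group\<^esub> b = a + b" "\<one>\<^bsub>base_group\<^esub> = 0"
  by (simp_all add: base_group_def)

lemma base_group_inv [simp]: "inv\<^bsub>base_group\<^esub> a = - a"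
  by (rule group.inv_equality[OF group_base_group]) simp_all

lemma subgroup_base_group_iff:
  "subgroup V0 base_group \<longleftrightarrow> 0 \<in> V0 \<and> (\<forall>a\<in>V0. \<forall>b\<in>V0. a - b \<in> V0)"
proof
  assume *: "subgroup V0 base_group"
  have "a - b \<in> V0" if "a \<in> V0" "b \<in> V0" for a b
    using subgroup.m_closed[OF * that(1) subgroup.m_inv_closed[OF * that(2)]] by simp
  then show "0 \<in> V0 \<and> (\<forall>a\<in>V0. \<forall>b\<in>V0. a - b \<in> V0)"
    using subgroup.one_closed[OF *] by simp
next
  assume *: "0 \<in> V0 \<and> (\<forall>a\<in>V0. \<forall>b\<in>V0. a - b \<in> V0)"
  then have neg: "- a \<in> V0" if "a \<in> V0" for a
    using that by (metis diff_0)
  then have "a + b \<in> V0" if "a \<in> V0" "b \<in> V0" for a b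
    using * that by (metis diff_minus_eq_add)
  with * neg show "subgroup V0 base_group"
    by (intro group.subgroupI[OF group_base_group]) auto
qed

lemma subgroup_base_group_closed:
  assumes "subgroup V0 base_group"
  shows "0 \<in> V0"
    and "a \<in> V0 \<Longrightarrow> b \<in> V0 \<Longrightarrow> a - b \<in> V0"
    and "a \<in> V0 \<Longrightarrow> - a \<in> V0"
    and "a \<in> V0 \<Longrightarrow> b \<in> V0 \<Longrightarrow> a + b \<in> V0"
proof -
  show zero: "0 \<in> V0"
    using assms by (auto simp: subgroup_base_group_iff)
  show diff: "a - b \<in> V0" if "a \<in> V0" "b \<in> V0" for a b
    using assms that by (auto simp: subgroup_base_group_iff)
  show neg: "- a \<in> V0" if "a \<in> V0" for a
    using diff[OF zero that] that by simp
  show "a + b \<in> V0" if "a \<in> V0" "b \<in> V0"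
    using diff[OF that(1) neg[OF that(2)]] by simp
qed

lemma coset_eq_iff:
  assumes "subgroup V0 base_group"
  shows "(+) v ` V0 = (+) w ` V0 \<longleftrightarrow> w \<in> (+) v ` V0"
proof
  note closed = subgroup_base_group_closed[OF assms]
  show "w \<in> (+) v ` V0" if "(+) v ` V0 = (+) w ` V0"
    using closed(1) that by force
  assume "w \<in> (+) v ` V0"
  then obtain u where u: "u \<in> V0" "w = v + u" by auto
  have "v + a \<in> (+) w ` V0" if "a \<in> V0" for a
    by (rule image_eqI[of _ _ "a - u"]) (use closed(2) u that in simp_all)
  moreover have "w + a \<in> (+) v ` V0" if "a \<in> V0" for a
    by (rule image_eqI[of _ _ "u + a"]) (use closed(4) u that in \<open>simp_all add: add.assoc\<close>)
  ultimately show "(+) v ` V0 = (+) w ` V0"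
    by blast
qed

section \<open>Powers in the lamplighter group and fibres of its subgroups\<close>

lemma xpow_power: "xpow s ^ m = xpow (s * int m)"
  by (induction m) (simp_all add: xpow_0 distrib_left flip: xpow_add)

lemma xpow_smult_xpow: "xpow s *s (xpow t *s v) = xpow (s + t) *s v"
  by (simp add: vector_smult_assoc xpow_add)

lemma lamplighter_mult [simp]:
  "(v, s) \<otimes>\<^bsub>lamplighter\<^esub> (w, t) = (v + xpow s *s w, s + t)"
  by (simp add: lamplighter_def)

lemma lamplighter_one [simp]: "\<one>\<^bsub>lamplighter\<^esub> = (0, 0)"
  by (simp add: lamplighter_def)

lemma lamplighter_carrier [simp]: "carrier lamplighter = UNIV"
  by (simp add: lamplighter_def)

lemma lamplighter_inv [simp]:
  "inv\<^bsub>lamplighter\<^esub> (v, s) = (- (xpow (- s) *s v), - s)"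
  by (rule group.inv_equality[OF group_lamplighter]) simp_all

text \<open>The successive factors contribute \<open>v\<close>, x^s \<open>v\<close>, x^(2s)
  \<open>v\<close> and so on to the first coordinate. This geometric sum is the source of
  \<open>phi\<close> in the inclusion criterion.\<close>

lemma lamplighter_pow:
  "(v, s) [^]\<^bsub>lamplighter\<^esub> (m::nat) = (phi m (xpow s) *s v, s * int m)"
  by (induction m)
    (simp_all add: phi_def xpow_power distrib_left vector_sadd_rdistrib nat_pow_def)

lemma snd_lamplighter_int_pow:
  "snd ((v, s) [^]\<^bsub>lamplighter\<^esub> (k::int)) = s * k"
  by (cases k rule: int_cases2)
    (simp_all add: int_pow_int group.int_pow_neg_int[OF group_lamplighter] lamplighter_pow)

text \<open>Multiplying \<open>(a, t)\<close> on the right by the inverse of \<open>(b, t)\<close>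
  gives \<open>(a - b, 0)\<close>. Hence a nonempty fibre of \<open>V\<close> over \<open>t\<close>
  is one coset of \<open>base_part V\<close>, whatever reference point \<open>(b, t)\<close> is
  chosen.\<close>

lemma subgroup_lamplighter_mem_iff:
  assumes "subgroup V lamplighter" and "(b, t) \<in> V"
  shows "(a, t) \<in> V \<longleftrightarrow> a - b \<in> base_part V"
proof
  assume "(a, t) \<in> V"
  from subgroup.m_closed[OF assms(1) this subgroup.m_inv_closed[OF assms]]
  show "a - b \<in> base_part V"
    by (simp add: base_part_def vector_smult_rneg xpow_smult_xpow xpow_0)
next
  assume "a - b \<in> base_part V"
  then have "(a - b, 0) \<in> V" by (simp add: base_part_def)
  from subgroup.m_closed[OF assms(1) this assms(2)] show "(a, t) \<in> V"
    by (simp add: xpow_0)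
qed

section \<open>The base part of a subgroup and its invariance under shifts\<close>

lemma subgroup_base_part:
  assumes "subgroup V lamplighter"
  shows "subgroup (base_part V) base_group"
proof -
  have "a - b \<in> base_part V" if "a \<in> base_part V" "b \<in> base_part V" for a b
    using subgroup_lamplighter_mem_iff[OF assms, of b 0 a] that by (simp add: base_part_def)
  moreover have "0 \<in> base_part V"
    using subgroup.one_closed[OF assms] by (simp add: base_part_def)
  ultimately show ?thesis by (simp add: subgroup_base_group_iff)
qed

text \<open>The product of \<open>(b, t)\<close> and \<open>(w, 0)\<close> lies in the same fibre as
  \<open>(b, t)\<close>, and their first coordinates differ by the shifted \<open>w\<close>. This
  replaces a computation of the conjugate.\<close>

lemma base_part_shift:
  assumes "subgroup V lamplighter" and "(b, t) \<in> V" and "w \<in> base_part V"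
  shows "xpow t *s w \<in> base_part V"
proof -
  have "(b, t) \<otimes>\<^bsub>lamplighter\<^esub> (w, 0) \<in> V"
    using assms by (intro subgroup.m_closed) (auto simp: base_part_def)
  then show ?thesis
    using subgroup_lamplighter_mem_iff[OF assms(1,2), of "b + xpow t *s w"] by simp
qed

lemma base_part_shift_eq:
  assumes "subgroup V lamplighter" and "(b, t) \<in> V"
  shows "(\<lambda>w. xpow t *s w) ` base_part V = base_part V"
proof
  show "(\<lambda>w. xpow t *s w) ` base_part V \<subseteq> base_part V"
    using base_part_shift[OF assms] by auto
  \<comment> \<open>The inverse of \<open>(b, t)\<close> lies over \<open>- t\<close>, so the base
    part is also stable under the opposite shift; this yields the reverse inclusion.\<close>
  have "(- (xpow (- t) *s b), - t) \<in> V"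
    using subgroup.m_inv_closed[OF assms] by simp
  then have "xpow (- t) *s w \<in> base_part V" if "w \<in> base_part V" for w
    using base_part_shift[OF assms(1)] that by blast
  moreover have "w = xpow t *s (xpow (- t) *s w)" for w :: "('a, 'b) base"
    by (simp add: xpow_smult_xpow xpow_0)
  ultimately show "base_part V \<subseteq> (\<lambda>w. xpow t *s w) ` base_part V"
    by blast
qed

section \<open>The subgroup with a given triple\<close>

lemma shift_int_mult_closed:
  assumes "(\<lambda>w. xpow s *s w) ` V0 = V0" and "w \<in> V0"
  shows "xpow (s * k) *s w \<in> V0"
proof (induction k rule: int_induct[where k = 0])
  case base
  then show ?case using assms by (simp add: xpow_0)
next
  case (step1 i)
  have "xpow (s * (i + 1)) *s w = xpow s *s (xpow (s * i) *s w)"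
    by (simp add: xpow_smult_xpow algebra_simps)
  then show ?case using step1 assms by blast
next
  case (step2 i)
  \<comment> \<open>Going down needs the shift to map \<open>V0\<close> onto itself, not merely into
    itself: the preimage \<open>u\<close> is the element shifted back.\<close>
  then obtain u where u: "u \<in> V0" "xpow (s * i) *s w = xpow s *s u"
    using assms by blast
  have "xpow (s * (i - 1)) *s w = xpow (- s) *s (xpow (s * i) *s w)"
    by (simp add: xpow_smult_xpow algebra_simps)
  also have "\<dots> = u"
    by (simp add: u xpow_smult_xpow xpow_0)
  finally show ?case using u by simp
qed

text \<open>This is the product of \<open>V0\<close> and the cyclic group generated by
  \<open>(v, s)\<close>, since left multiplication by \<open>(u, 0)\<close> only adds
  \<open>u\<close> to the first coordinate. For \<open>s = 0\<close> the exponent \<open>k\<close>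
  is not determined by \<open>t\<close>.\<close>

definition triple_subgroup ::
  "nat \<Rightarrow> ('p::prime_card, 'n::finite) base set \<Rightarrow> ('p, 'n) base \<Rightarrow> (('p, 'n) base \<times> int) set" where
  "triple_subgroup s V0 v =
    {(w, t). \<exists>k. t = int s * k \<and> w - fst ((v, int s) [^]\<^bsub>lamplighter\<^esub> k) \<in> V0}"

lemma has_triple_imp_eq_triple_subgroup:
  assumes "subgroup V lamplighter" and "has_triple V s V0 v"
  shows "V = triple_subgroup s V0 v"
proof -
  define g where "g = (v, int s)"
  have V0: "V0 = base_part V" and im: "snd ` V = range (\<lambda>k. int s * k)" and "g \<in> V"
    using assms(2) by (auto simp: has_triple_def g_def)
  have "g [^]\<^bsub>lamplighter\<^esub> k \<in> V" for k :: int
    using group.subgroup_int_pow_closed[OF group_lamplighter assms(1) \<open>g \<in> V\<close>] .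
  moreover have "g [^]\<^bsub>lamplighter\<^esub> k = (fst (g [^]\<^bsub>lamplighter\<^esub> k), int s * k)" for k :: int
    by (metis g_def prod.collapse snd_lamplighter_int_pow)
  ultimately have "(fst (g [^]\<^bsub>lamplighter\<^esub> k), int s * k) \<in> V" for k
    by metis
  \<comment> \<open>The power of \<open>g\<close> serves as the reference point of the fibre of
    \<open>V\<close> over \<open>s * k\<close>.\<close>
  then have iff: "(w, int s * k) \<in> V \<longleftrightarrow> w - fst (g [^]\<^bsub>lamplighter\<^esub> k) \<in> V0" for w k
    unfolding V0 by (rule subgroup_lamplighter_mem_iff[OF assms(1)])
  have "\<exists>k. t = int s * k" if "(w, t) \<in> V" for w t
    using that im by (metis image_eqI rangeE snd_conv)
  with iff show ?thesis
    by (fastforce simp: triple_subgroup_def simp flip: g_def)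
qed

lemma triple_subgroup_closed:
  assumes "admissible s V0 v"
  shows "subgroup (triple_subgroup s V0 v) lamplighter"
proof -
  define c where "c k = fst ((v, int s) [^]\<^bsub>lamplighter\<^esub> k)" for k :: int
  have pow: "(v, int s) [^]\<^bsub>lamplighter\<^esub> k = (c k, int s * k)" for k :: int
    by (metis c_def prod.collapse snd_lamplighter_int_pow)
  \<comment> \<open>The first coordinate of the powers is a crossed homomorphism. With this law,
    closure under products and inverses reduces to the stability of \<open>V0\<close> under shifts
    by multiples of \<open>s\<close>.\<close>
  have c_add: "c (k + l) = c k + xpow (int s * k) *s c l" for k l
    using group.int_pow_mult[OF group_lamplighter, of "(v, int s)" k l] by (simp add: pow)
  have c_0: "c 0 = 0"
    by (simp add: c_def)
  have sub: "subgroup V0 base_group" and shift: "(\<lambda>w. xpow (int s) *s w) ` V0 = V0"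
    using assms by (auto simp: admissible_def)
  note closed = subgroup_base_group_closed[OF sub]
  have mem: "p \<in> triple_subgroup s V0 v \<longleftrightarrow> (\<exists>k u. u \<in> V0 \<and> p = (u + c k, int s * k))" for p
    by (cases p) (force simp: triple_subgroup_def simp flip: c_def)
  show ?thesis
  proof (rule group.subgroupI[OF group_lamplighter])
    show "triple_subgroup s V0 v \<noteq> {}"
      using mem closed(1) by blast
  next
    fix p assume "p \<in> triple_subgroup s V0 v"
    then obtain k u where u: "u \<in> V0" and p: "p = (u + c k, int s * k)"
      using mem by blast
    have "c (- k) = - (xpow (int s * - k) *s c k)"
      using c_add[of "- k" k] by (simp add: c_0 eq_neg_iff_add_eq_0)
    then have "inv\<^bsub>lamplighter\<^esub> p = (- (xpow (int s * - k) *s u) + c (- k), int s * - k)"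
      by (simp add: p vector_add_ldistrib)
    then show "inv\<^bsub>lamplighter\<^esub> p \<in> triple_subgroup s V0 v"
      using closed(3)[OF shift_int_mult_closed[OF shift u]] mem by blast
  next
    fix p q assume "p \<in> triple_subgroup s V0 v" "q \<in> triple_subgroup s V0 v"
    then obtain k u l w where "u \<in> V0" and p: "p = (u + c k, int s * k)"
      and "w \<in> V0" and q: "q = (w + c l, int s * l)"
      using mem by meson
    then have "u + xpow (int s * k) *s w \<in> V0"
      using closed(4) shift_int_mult_closed[OF shift] by blast
    moreover have "p \<otimes>\<^bsub>lamplighter\<^esub> q =
        ((u + xpow (int s * k) *s w) + c (k + l), int s * (k + l))"
      by (simp add: p q c_add vector_add_ldistrib algebra_simps)
    ultimately show "p \<otimes>\<^bsub>lamplighter\<^esub> q \<in> triple_subgroup s V0 v"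
      using mem by blast
  qed simp
qed

text \<open>Elements over 0 come from exponents \<open>k\<close> with \<open>s * k = 0\<close>. For
  positive \<open>s\<close> this leaves \<open>k = 0\<close>; for \<open>s = 0\<close> every
  \<open>k\<close> occurs, and admissibility puts \<open>v\<close> and so all its multiples in
  \<open>V0\<close>.\<close>

lemma base_part_triple_subgroup:
  assumes "admissible s V0 v"
  shows "base_part (triple_subgroup s V0 v) = V0"
proof -
  define c where "c k = fst ((v, int s) [^]\<^bsub>lamplighter\<^esub> k)" for k :: int
  have sub: "subgroup V0 base_group"
    using assms by (simp add: admissible_def)
  note closed = subgroup_base_group_closed[OF sub]
  have "c k \<in> V0" if "int s * k = 0" for k
  proof (cases "k = 0")
    case True
    then show ?thesis using closed(1) by (simp add: c_def)
  next
    case False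
    then have "s = 0" "v \<in> V0" using that assms by (auto simp: admissible_def)
    \<comment> \<open>For \<open>s = 0\<close> the shift is the identity, so the powers of
      \<open>(v, 0)\<close> have the multiples of \<open>v\<close> as first coordinates.\<close>
    have nat: "phi m 1 *s v \<in> V0" for m
      by (induction m)
        (use closed \<open>v \<in> V0\<close> in \<open>auto simp: phi_def vector_sadd_rdistrib\<close>)
    show ?thesis
      by (cases k rule: int_cases2)
        (use nat closed(3) \<open>s = 0\<close> in \<open>simp_all add: c_def int_pow_int lamplighter_pow
          group.int_pow_neg_int[OF group_lamplighter] xpow_0\<close>)
  qed
  then have "w \<in> V0" if "int s * k = 0" "w - c k \<in> V0" for w k
    using closed(4)[of "w - c k" "c k"] that by simp
  moreover have "\<exists>k. int s * k = 0 \<and> w - c k \<in> V0" if "w \<in> V0" for w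
    using that by (intro exI[of _ 0]) (simp add: c_def)
  ultimately have "(\<exists>k. 0 = int s * k \<and> w - c k \<in> V0) \<longleftrightarrow> w \<in> V0" for w
    by metis
  then have "(w, 0) \<in> triple_subgroup s V0 v \<longleftrightarrow> w \<in> V0" for w
    by (simp only: triple_subgroup_def mem_Collect_eq case_prod_conv c_def)
  then show ?thesis
    by (simp add: base_part_def)
qed

lemma has_triple_triple_subgroup:
  assumes "admissible s V0 v"
  shows "has_triple (triple_subgroup s V0 v) s V0 v"
proof -
  have "0 \<in> V0"
    using assms subgroup_base_group_closed(1) by (auto simp: admissible_def)
  have "(fst ((v, int s) [^]\<^bsub>lamplighter\<^esub> k), int s * k) \<in> triple_subgroup s V0 v" for k
    using \<open>0 \<in> V0\<close> by (auto simp: triple_subgroup_def)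
  from this[of 1] this
  have "(v, int s) \<in> triple_subgroup s V0 v"
    and "range (\<lambda>k. int s * k) \<subseteq> snd ` triple_subgroup s V0 v"
    by (simp add: group.int_pow_1[OF group_lamplighter], force)
  moreover have "snd ` triple_subgroup s V0 v \<subseteq> range (\<lambda>k. int s * k)"
    by (auto simp: triple_subgroup_def)
  ultimately show ?thesis
    using base_part_triple_subgroup[OF assms] by (auto simp: has_triple_def)
qed

section \<open>Existence, uniqueness and comparison of triples\<close>

lemma ex_has_triple:
  assumes "subgroup V lamplighter"
  shows "\<exists>s V0 v. has_triple V s V0 v"
proof -
  have "0 \<in> snd ` V"
    using subgroup.one_closed[OF assms] by force
  moreover have "a - b \<in> snd ` V" if "a \<in> snd ` V" "b \<in> snd ` V" for a b
  proof -
    obtain w u where "(w, a) \<in> V" "(u, b) \<in> V" using \<open>a \<in> snd ` V\<close> \<open>b \<in> snd ` V\<close> by auto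
    then have "(w, a) \<otimes>\<^bsub>lamplighter\<^esub> inv\<^bsub>lamplighter\<^esub> (u, b) \<in> V"
      using assms by (blast intro: subgroup.m_closed subgroup.m_inv_closed)
    then show ?thesis by force
  qed
  ultimately obtain s where s: "snd ` V = range (\<lambda>k. int s * k)"
    by (rule int_subgroup_eq_range)
  then have "int s * 1 \<in> snd ` V" by blast
  then obtain v where "(v, int s) \<in> V" by auto
  with s show ?thesis by (auto simp: has_triple_def)
qed

text \<open>Shift invariance is \<open>base_part_shift_eq\<close> at the element
  \<open>(v, s)\<close> of \<open>V\<close>. For \<open>s = 0\<close> that element lies in the base
  group, so \<open>v\<close> is in \<open>V0\<close>.\<close>

lemma has_triple_imp_admissible:
  assumes "subgroup V lamplighter" and "has_triple V s V0 v"
  shows "admissible s V0 v"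
  using assms base_part_shift_eq[OF assms(1), of v "int s"] subgroup_base_part[OF assms(1)]
  by (auto simp: admissible_def has_triple_def base_part_def)

text \<open>A subgroup of the integers has one generator in \<open>nat\<close>, \<open>V0\<close> is
  a function of \<open>V\<close>, and the possible \<open>v\<close> form the fibre of
  \<open>V\<close> over \<open>s\<close>, which is a coset of \<open>V0\<close>.\<close>

lemma has_triple_iff:
  assumes "subgroup V lamplighter" and "has_triple V s V0 v"
  shows "has_triple V s' V0' v' \<longleftrightarrow> s' = s \<and> V0' = V0 \<and> v' \<in> (+) v ` V0"
proof -
  have "(v', int s) \<in> V \<longleftrightarrow> v' - v \<in> V0"
    using subgroup_lamplighter_mem_iff[OF assms(1)] assms(2) by (simp add: has_triple_def)
  also have "\<dots> \<longleftrightarrow> v' \<in> (+) v ` V0"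
    by (force simp: image_iff)
  finally show ?thesis
    using assms(2) by (auto simp: has_triple_def range_int_mult_eq_iff)
qed

lemma subgroup_eq_iff_triples:
  assumes "subgroup V lamplighter" and "has_triple V s V0 v"
    and "subgroup V' lamplighter" and "has_triple V' s' V0' v'"
  shows "V = V' \<longleftrightarrow> s = s' \<and> V0 = V0' \<and> (+) v ` V0 = (+) v' ` V0'"
proof -
  have sub: "subgroup V0 base_group"
    using has_triple_imp_admissible[OF assms(1,2)] by (simp add: admissible_def)
  \<comment> \<open>If \<open>V\<close> also has the triple of \<open>V'\<close>, both equal
    \<open>triple_subgroup s' V0' v'\<close>.\<close>
  have "V = V' \<longleftrightarrow> has_triple V s' V0' v'"
    using assms has_triple_imp_eq_triple_subgroup by metis
  also have "\<dots> \<longleftrightarrow> s = s' \<and> V0 = V0' \<and> (+) v ` V0 = (+) v' ` V0'"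
    unfolding has_triple_iff[OF assms(1,2)] using coset_eq_iff[OF sub] by metis
  finally show ?thesis .
qed

lemma subgroup_subset_iff_triples:
  assumes "subgroup V lamplighter" and "has_triple V s V0 v"
    and "subgroup V' lamplighter" and "has_triple V' s' V0' v'"
  shows "V \<subseteq> V' \<longleftrightarrow> s' dvd s \<and> V0 \<subseteq> V0' \<and>
    v - phi (s div s') (xpow (int s')) *s v' \<in> V0'"
proof -
  have V0: "V0 = base_part V" "V0' = base_part V'"
    and v: "(v, int s) \<in> V" "(v', int s') \<in> V'"
    and im: "snd ` V = range (\<lambda>k. int s * k)" "snd ` V' = range (\<lambda>k. int s' * k)"
    using assms by (auto simp: has_triple_def)
  have iff: "(v, int s) \<in> V' \<longleftrightarrow> v - phi (s div s') (xpow (int s')) *s v' \<in> V0'" if "s' dvd s"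
  proof -
    have "(v', int s') [^]\<^bsub>lamplighter\<^esub> int (s div s') \<in> V'"
      using group.subgroup_int_pow_closed[OF group_lamplighter assms(3) v(2)] .
    \<comment> \<open>This includes \<open>s' = 0\<close>: divisibility then forces
      \<open>s = 0\<close>, and both sides vanish.\<close>
    moreover have "int s' * int (s div s') = int s"
      using that by (metis dvd_mult_div_cancel of_nat_mult)
    ultimately have "(phi (s div s') (xpow (int s')) *s v', int s) \<in> V'"
      by (simp add: int_pow_int lamplighter_pow)
    then show ?thesis
      unfolding V0 by (rule subgroup_lamplighter_mem_iff[OF assms(3)])
  qed
  show ?thesis
  proof
    assume "V \<subseteq> V'"
    then have "snd ` V \<subseteq> snd ` V'" and "V0 \<subseteq> V0'"
      by (auto simp: V0 base_part_def)
    then show "s' dvd s \<and> V0 \<subseteq> V0' \<and> v - phi (s div s') (xpow (int s')) *s v' \<in> V0'"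
      using iff v \<open>V \<subseteq> V'\<close> by (auto simp: im range_int_mult_subset_iff)
  next
    assume *: "s' dvd s \<and> V0 \<subseteq> V0' \<and> v - phi (s div s') (xpow (int s')) *s v' \<in> V0'"
    then have pow: "(v, int s) [^]\<^bsub>lamplighter\<^esub> k \<in> V'" for k :: int
      using group.subgroup_int_pow_closed[OF group_lamplighter assms(3)] iff by blast
    have "(w, t) \<in> V'" if "(w, t) \<in> V" for w t
    proof -
      have "(w, t) \<in> triple_subgroup s V0 v"
        using that has_triple_imp_eq_triple_subgroup[OF assms(1,2)] by simp
      then obtain k where k: "t = int s * k" "w - fst ((v, int s) [^]\<^bsub>lamplighter\<^esub> k) \<in> V0"
        by (auto simp: triple_subgroup_def)
      \<comment> \<open>The power of \<open>(v, s)\<close> over \<open>t\<close> lies in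
        \<open>V'\<close>, and \<open>w\<close> differs from its first coordinate by an element of
        \<open>V0\<close>, hence of \<open>V0'\<close>; so \<open>(w, t)\<close> is in the same
        fibre of \<open>V'\<close>.\<close>
      have "(fst ((v, int s) [^]\<^bsub>lamplighter\<^esub> k), t) \<in> V'"
        using pow[of k] by (metis k(1) prod.collapse snd_lamplighter_int_pow)
      from subgroup_lamplighter_mem_iff[OF assms(3) this] show ?thesis
        using k(2) * by (auto simp: V0)
    qed
    then show "V \<subseteq> V'" by auto
  qed
qed

theorem lemma3p1:
  shows
    "(\<forall>V :: (('p::prime_card, 'n::finite) base \<times> int) set. subgroup V lamplighter \<longrightarrow>
        (\<exists>s V0 v. has_triple V s V0 v) \<and>
        (\<forall>s V0 v. has_triple V s V0 v \<longrightarrow>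
           admissible s V0 v \<and>
           (\<forall>s' V0' v'. has_triple V s' V0' v' \<longleftrightarrow>
              s' = s \<and> V0' = V0 \<and> v' \<in> (+) v ` V0) \<and>
           (s = 0 \<longrightarrow> has_triple V s V0 0)))
     \<and>
     (\<forall>s (V0 :: ('p, 'n) base set) v. admissible s V0 v \<longrightarrow>
        (\<exists>!V. subgroup V lamplighter \<and> has_triple V s V0 v))
     \<and>
     (\<forall>s (V0 :: ('p, 'n) base set) v s' V0' v' V V'.
        admissible s V0 v \<and> admissible s' V0' v' \<and>
        subgroup V lamplighter \<and> has_triple V s V0 v \<and>
        subgroup V' lamplighter \<and> has_triple V' s' V0' v' \<longrightarrow>
        (V = V' \<longleftrightarrow> s = s' \<and> V0 = V0' \<and> (+) v ` V0 = (+) v' ` V0'))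
     \<and>
     (\<forall>(V :: (('p, 'n) base \<times> int) set) V' s V0 v s' V0' v'.
        subgroup V lamplighter \<and> has_triple V s V0 v \<and>
        subgroup V' lamplighter \<and> has_triple V' s' V0' v' \<longrightarrow>
        (V \<subseteq> V' \<longleftrightarrow>
           s' dvd s \<and> V0 \<subseteq> V0' \<and>
           v - phi (s div s') (xpow (int s')) *s v' \<in> V0'))"
proof (intro conjI)
  show "\<forall>V :: (('p, 'n) base \<times> int) set. subgroup V lamplighter \<longrightarrow>
        (\<exists>s V0 v. has_triple V s V0 v) \<and>
        (\<forall>s V0 v. has_triple V s V0 v \<longrightarrow>
           admissible s V0 v \<and>
           (\<forall>s' V0' v'. has_triple V s' V0' v' \<longleftrightarrow>
              s' = s \<and> V0' = V0 \<and> v' \<in> (+) v ` V0) \<and>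
           (s = 0 \<longrightarrow> has_triple V s V0 0))"
  proof (intro allI impI conjI)
    fix V :: "(('p, 'n) base \<times> int) set" and s V0 v
    assume V: "subgroup V lamplighter"
    show "\<exists>s V0 v. has_triple V s V0 v"
      using ex_has_triple[OF V] .
    assume triple: "has_triple V s V0 v"
    show "admissible s V0 v"
      using has_triple_imp_admissible[OF V triple] .
    show "has_triple V s' V0' v' \<longleftrightarrow> s' = s \<and> V0' = V0 \<and> v' \<in> (+) v ` V0" for s' V0' v'
      using has_triple_iff[OF V triple] .
    \<comment> \<open>The identity of \<open>V\<close> lies over 0, which makes 0 a valid choice of
      \<open>v\<close>.\<close>
    show "has_triple V s V0 0" if "s = 0"
      using subgroup.one_closed[OF V] triple that by (simp add: has_triple_def)
  qed
next
  show "\<forall>s (V0 :: ('p, 'n) base set) v. admissible s V0 v \<longrightarrow>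
        (\<exists>!V. subgroup V lamplighter \<and> has_triple V s V0 v)"
  proof (intro allI impI ex1I)
    fix s v and V0 :: "('p, 'n) base set"
    assume "admissible s V0 v"
    then show "subgroup (triple_subgroup s V0 v) lamplighter \<and>
        has_triple (triple_subgroup s V0 v) s V0 v"
      using triple_subgroup_closed has_triple_triple_subgroup by blast
  qed (use has_triple_imp_eq_triple_subgroup in blast)
qed (intro allI impI, elim conjE, rule subgroup_eq_iff_triples subgroup_subset_iff_triples,
  assumption+)+

end
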